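(* Let $S\ge1$ and let $\hat\theta_h(x_0)$ be an estimator of $\theta(x_0)$ with bandwidth $h$, where $\theta\in\Theta_{x_0}=\Theta_{x_0}(M_S,r_S,\psi_n)$. Assume that the deterministic bias envelope and the stochastic scale satisfy $$\sup_{\theta\in\Theta_{x_0}}\big|\mathbb E[\hat\theta_h(x_0)]-\theta(x_0)\big|=\eta h^S,\qquad \sigma_n(h):=\sqrt{\mathrm{Var}(\hat\theta_h(x_0))}=\sqrt{\frac{C_V}{nh}}$$ for some fixed $\eta,C_V>0$. Let $R_{\mathrm{FLCI},k}(\alpha;\eta)$ and $R_{\mathrm{EBCI},k}(\alpha;\eta)$ denote the oracle radii of the $k$-sided FLCI and EBCI, $k=1,2$, where the two-sided EBCI allocates probability $\alpha/2$ to each tail. Then, as $\alpha\downarrow0$, $$\frac{R_{\mathrm{EBCI},1}(\alpha;\eta)}{R_{\mathrm{FLCI},1}(\alpha;\eta)}=1+o(1),\qquad \frac{R_{\mathrm{EBCI},2}(\alpha;\eta)}{R_{\mathrm{FLCI},2}(\alpha;\eta)}=\Big(\frac{\log(2/\alpha)}{\log(1/\alpha)}\Big)^{\frac S{2S+1}}(1+o(1)).$$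
   Context: $\Theta_{x_0}(M_S,r_S,\psi_n)$, with $\psi_n=n^{-1/(2S+1)}\log n$, is the class of functions $\theta$ with $\big|\theta(x_0+\epsilon)-\theta(x_0)-\sum_{s=1}^S\frac{\theta^{(s)}(x_0)}{s!}\epsilon^s\big|\le M_Sr_S(|\epsilon|)|\epsilon|^S$ for all $|\epsilon|\le\psi_n$, where $M_S>0$ and $r_S:[0,\infty)\to[0,\infty)$ is nondecreasing with $r_S(t)\to0$ as $t\downarrow0$. (It enters the statement only through the bias envelope $\eta h^S$.) Oracle radii, for fixed $n$: let $t(h)=\eta h^S/\sigma_n(h)$, let $\operatorname{cv}_{1-\alpha}(t)$ be the $(1-\alpha)$-quantile of the folded normal distribution $|\mathcal N(t,1)|$ and $z_{1-\alpha}$ the $(1-\alpha)$-quantile of $\mathcal N(0,1)$. The fixed-length confidence interval (FLCI) radii are $$R_{\mathrm{FLCI},2}(\alpha;\eta)=\inf_{h>0}\sigma_n(h)\operatorname{cv}_{1-\alpha}(t(h))=\eta^{\frac1{2S+1}}\Big(\frac{C_V}n\Big)^{\frac S{2S+1}}\inf_{t>0}\big\{t^{-\frac1{2S+1}}\operatorname{cv}_{1-\alpha}(t)\big\},\qquad R_{\mathrm{FLCI},1}(\alpha;\eta)=\inf_{h>0}\{\eta h^S+\sigma_n(h)z_{1-\alpha}\}.$$ The empirical Bernstein confidence interval (EBCI) radii are $$R_{\mathrm{EBCI},1}(\alpha;\eta)=\inf_{h>0}\Big\{\sqrt{\frac{2\log(1/\alpha)C_V}{nh}}+\eta h^S\Big\}=(2S+1)\eta^{\frac1{2S+1}}\Big(\frac{2\log(1/\alpha)C_V}{4S^2n}\Big)^{\frac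 S{2S+1}},\qquad R_{\mathrm{EBCI},2}(\alpha;\eta)=R_{\mathrm{EBCI},1}(\alpha/2;\eta).$$ *)

theory Defs
  imports "HOL-Probability.Probability" "HOL-Library.Landau_Symbols"
begin

(* The iterated derivative (deriv ^^ s) f is only meaningful at x if the lower ones exist
   on a whole neighbourhood of x, hence the second conjunct. *)
definition times_differentiable_at :: "nat \<Rightarrow> (real \<Rightarrow> real) \<Rightarrow> real \<Rightarrow> bool" where
  "times_differentiable_at S f x \<longleftrightarrow>
     (\<forall>s<S. (deriv ^^ s) f differentiable at x) \<and>
     (\<forall>s. Suc s < S \<longrightarrow> (\<forall>\<^sub>F y in nhds x. (deriv ^^ s) f differentiable at y))"

definition taylor_class ::
    "nat \<Rightarrow> real \<Rightarrow> real \<Rightarrow> (real \<Rightarrow> real) \<Rightarrow> real \<Rightarrow> (real \<Rightarrow> real) set" where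
  "taylor_class S x\<^sub>0 M r \<psi> =
     {\<theta>. times_differentiable_at S \<theta> x\<^sub>0 \<and>
         (\<forall>\<epsilon>. \<bar>\<epsilon>\<bar> \<le> \<psi> \<longrightarrow>
            \<bar>\<theta> (x\<^sub>0 + \<epsilon>) - \<theta> x\<^sub>0 - (\<Sum>s=1..S. (deriv ^^ s) \<theta> x\<^sub>0 / fact s * \<epsilon> ^ s)\<bar>
              \<le> M * r \<bar>\<epsilon>\<bar> * \<bar>\<epsilon>\<bar> ^ S)}"

definition window :: "nat \<Rightarrow> nat \<Rightarrow> real" where
  "window S n = real n powr (- 1 / (2 * real S + 1)) * ln (real n)"

definition quantile :: "real measure \<Rightarrow> real \<Rightarrow> real" where
  "quantile M p = Inf {x. p \<le> cdf M x}"

definition folded_normal :: "real \<Rightarrow> real measure" where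
  "folded_normal t = distr (density lborel (normal_density t 1)) borel abs"

definition z_quantile :: "real \<Rightarrow> real" where
  "z_quantile p = quantile std_normal_distribution p"

definition cv :: "real \<Rightarrow> real \<Rightarrow> real" where
  "cv p t = quantile (folded_normal t) p"

(* In the radii, \<sigma> is the standard deviation as a function of the bandwidth.  The infima are
   taken in the reals; flci_radius1 is the infimum of a set bounded below only when the normal
   quantile is nonnegative, i.e. for \<alpha> \<le> 1/2. *)
definition flci_radius1 :: "nat \<Rightarrow> (real \<Rightarrow> real) \<Rightarrow> real \<Rightarrow> real \<Rightarrow> real" where
  "flci_radius1 S \<sigma> \<alpha> \<eta> = (INF h\<in>{0<..}. \<eta> * h ^ S + \<sigma> h * z_quantile (1 - \<alpha>))"

definition flci_radius2 :: "nat \<Rightarrow> (real \<Rightarrow> real) \<Rightarrow> real \<Rightarrow> real \<Rightarrow> real" where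
  "flci_radius2 S \<sigma> \<alpha> \<eta> = (INF h\<in>{0<..}. \<sigma> h * cv (1 - \<alpha>) (\<eta> * h ^ S / \<sigma> h))"

definition ebci_radius1 :: "nat \<Rightarrow> nat \<Rightarrow> real \<Rightarrow> real \<Rightarrow> real \<Rightarrow> real" where
  "ebci_radius1 S n C \<alpha> \<eta> =
     (INF h\<in>{0<..}. sqrt (2 * ln (1 / \<alpha>) * C / (real n * h)) + \<eta> * h ^ S)"

definition ebci_radius2 :: "nat \<Rightarrow> nat \<Rightarrow> real \<Rightarrow> real \<Rightarrow> real \<Rightarrow> real" where
  "ebci_radius2 S n C \<alpha> \<eta> = ebci_radius1 S n C (\<alpha> / 2) \<eta>"

end

theory Submission
  imports Defs "HOL-Real_Asymp.Real_Asymp"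
begin

text \<open>
  Write \<open>\<sigma> h = a / sqrt h\<close> with \<open>a = sqrt (C\<^sub>V / n)\<close> and let \<open>G u\<close>, formally
  \<open>radius S \<eta> u\<close>, be the infimum of \<open>\<eta> * h ^ S + u / sqrt h\<close> over the bandwidths \<open>h > 0\<close>: the
  radius that results when the bias is added to a fixed multiple of the standard deviation.  The EBCI radii are \<open>G (a * sqrt (2 * ln (k / \<alpha>)))\<close>
  for \<open>k = 1, 2\<close>.

  For the FLCI radii only the first-order size of the critical values matters.  The Chernoff bound
  \<open>exp (- (x\<^sup>2 / 2))\<close> for each Gaussian tail gives \<open>z_quantile (1 - \<alpha>) \<le> sqrt (2 * ln (1 / \<alpha>))\<close> and
  \<open>cv (1 - \<alpha>) t \<le> t + sqrt (2 * ln (2 / \<alpha>))\<close>; these are the values used by the EBCI, so the FLCI is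
  never longer.  Conversely the mass that the Gaussian puts on a unit interval bounds its upper tail
  from below, so that both \<open>z_quantile (1 - \<alpha>)\<close> and \<open>cv (1 - \<alpha>) t - t\<close> are, for small \<open>\<alpha>\<close>, at least
  \<open>crit_lower \<alpha> = sqrt (2 * ln (1 / (3 * \<alpha>))) - 1\<close>; for the folded normal this holds because
  ignoring the left tail of \<open>N(t, 1)\<close> leaves the one-sided problem.  Hence
  \<open>G (a * crit_lower \<alpha>) \<le> FLCI radius \<le> EBCI radius = G (a * sqrt (2 * ln (k / \<alpha>)))\<close>.

  Since \<open>G\<close> is nondecreasing with \<open>G (l * u) \<le> l * G u\<close> for \<open>l \<ge> 1\<close>, the ratio of the radii lies between
  \<open>1\<close> and \<open>sqrt (2 * ln (k / \<alpha>)) / crit_lower \<alpha>\<close>, which tends to \<open>1\<close> as \<open>\<alpha> \<down> 0\<close>.  This settles the one-sided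
  claim, and also the two-sided one: the factor
  \<open>(ln (2 / \<alpha>) / ln (1 / \<alpha>)) powr (S / (2 * S + 1))\<close> tends to \<open>1\<close> itself, so dividing by it
  changes the ratio only by a factor \<open>1 + o(1)\<close>.
\<close>

section \<open>Gaussian tails\<close>

abbreviation gauss :: "real \<Rightarrow> real measure" where
  "gauss \<mu> \<equiv> density lborel (normal_density \<mu> 1)"

text \<open>
  The Chernoff bound without moment generating functions: on the half-line beyond \<open>\<mu> + s\<close> (to the
  right if \<open>s \<ge> 0\<close>, to the left if \<open>s \<le> 0\<close>) the density centred at \<open>\<mu>\<close> is at most \<open>exp (- (s\<^sup>2 / 2))\<close>
  times the density centred at \<open>\<mu> + s\<close>, which has total mass \<open>1\<close>.
\<close>

lemma gauss_chernoff:
  assumes A: "A \<in> sets borel" and beyond: "\<And>y. y \<in> A \<Longrightarrow> s * (y - \<mu> - s) \<ge> 0"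
  shows "measure (gauss \<mu>) A \<le> exp (- (s\<^sup>2 / 2))"
proof -
  interpret M: prob_space "gauss \<mu>" by (rule prob_space_normal_density) simp
  interpret N: prob_space "gauss (\<mu> + s)" by (rule prob_space_normal_density) simp
  have le: "normal_density \<mu> 1 y \<le> exp (- (s\<^sup>2 / 2)) * normal_density (\<mu> + s) 1 y" if "y \<in> A" for y
  proof -
    have "(y - \<mu>)\<^sup>2 = s\<^sup>2 + (y - (\<mu> + s))\<^sup>2 + 2 * (s * (y - \<mu> - s))"
      by (simp add: power2_eq_square algebra_simps)
    also have "\<dots> \<ge> s\<^sup>2 + (y - (\<mu> + s))\<^sup>2"
      using beyond[OF that] by simp
    finally have "s\<^sup>2 + (y - (\<mu> + s))\<^sup>2 \<le> (y - \<mu>)\<^sup>2" .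
    then have "- ((y - \<mu>)\<^sup>2 / 2) \<le> - (s\<^sup>2 / 2) + - ((y - (\<mu> + s))\<^sup>2 / 2)"
      by argo
    then have "exp (- ((y - \<mu>)\<^sup>2 / 2)) \<le> exp (- (s\<^sup>2 / 2)) * exp (- ((y - (\<mu> + s))\<^sup>2 / 2))"
      by (metis exp_add exp_le_cancel_iff)
    then show ?thesis
      by (simp add: normal_density_def divide_right_mono)
  qed
  have "emeasure (gauss \<mu>) A = (\<integral>\<^sup>+y. ennreal (normal_density \<mu> 1 y) * indicator A y \<partial>lborel)"
    using A by (intro emeasure_density) auto
  also have "\<dots> \<le> (\<integral>\<^sup>+y. ennreal (exp (- (s\<^sup>2 / 2))) *
                       (ennreal (normal_density (\<mu> + s) 1 y) * indicator A y) \<partial>lborel)"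
    using le by (intro nn_integral_mono)
      (auto simp: indicator_def ennreal_mult[symmetric] intro!: ennreal_leI)
  also have "\<dots> = ennreal (exp (- (s\<^sup>2 / 2))) *
                  (\<integral>\<^sup>+y. ennreal (normal_density (\<mu> + s) 1 y) * indicator A y \<partial>lborel)"
    using A by (intro nn_integral_cmult) auto
  also have "(\<integral>\<^sup>+y. ennreal (normal_density (\<mu> + s) 1 y) * indicator A y \<partial>lborel)
               = emeasure (gauss (\<mu> + s)) A"
    using A by (intro emeasure_density[symmetric]) auto
  also have "ennreal (exp (- (s\<^sup>2 / 2))) * emeasure (gauss (\<mu> + s)) A \<le> ennreal (exp (- (s\<^sup>2 / 2))) * 1"
    by (intro mult_left_mono N.emeasure_le_1) auto
  finally show ?thesis
    by (simp add: M.emeasure_eq_measure)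
qed

text \<open>
  On the unit interval to the right of \<open>\<mu> + y\<close> the density is at least its value at the far end
  \<open>\<mu> + y + 1\<close>; the constant \<open>3\<close> is a convenient bound for \<open>sqrt (2 * pi)\<close>.
\<close>

lemma gauss_tail_lower_bound:
  assumes "y \<ge> 0"
  shows "exp (- ((y + 1)\<^sup>2 / 2)) / 3 \<le> measure (gauss \<mu>) {\<mu> + y<..}"
proof -
  interpret M: prob_space "gauss \<mu>" by (rule prob_space_normal_density) simp
  let ?k = "exp (- ((y + 1)\<^sup>2 / 2)) / 3"
  let ?I = "{\<mu> + y<..\<mu> + y + 1}"
  have le: "?k \<le> normal_density \<mu> 1 v" if "v \<in> ?I" for v
  proof -
    have "(v - \<mu>)\<^sup>2 \<le> (y + 1)\<^sup>2"
      using that assms by (intro power_mono) auto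
    then have "exp (- ((y + 1)\<^sup>2 / 2)) \<le> exp (- ((v - \<mu>)\<^sup>2 / 2))"
      by simp
    moreover have "sqrt (2 * pi) \<le> 3"
      using pi_less_4 by (intro real_le_lsqrt) auto
    ultimately have "?k \<le> exp (- ((v - \<mu>)\<^sup>2 / 2)) / sqrt (2 * pi)"
      by (intro frac_le) auto
    then show ?thesis
      by (simp add: normal_density_def)
  qed
  have "ennreal ?k = (\<integral>\<^sup>+v. ennreal ?k * indicator ?I v \<partial>lborel)"
    by (simp add: nn_integral_cmult_indicator)
  also have "\<dots> \<le> (\<integral>\<^sup>+v. ennreal (normal_density \<mu> 1 v) * indicator ?I v \<partial>lborel)"
    using le by (intro nn_integral_mono) (auto simp: indicator_def intro!: ennreal_leI)
  also have "\<dots> = emeasure (gauss \<mu>) ?I"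
    by (intro emeasure_density[symmetric]) auto
  also have "\<dots> \<le> emeasure (gauss \<mu>) {\<mu> + y<..}"
    by (intro emeasure_mono) auto
  finally show ?thesis
    by (simp add: M.emeasure_eq_measure)
qed

section \<open>Critical values\<close>

lemma quantile_between:
  assumes "\<And>y. p \<le> cdf M y \<Longrightarrow> l \<le> y" and "p \<le> cdf M u"
  shows "l \<le> quantile M p" and "quantile M p \<le> u"
proof -
  show "l \<le> quantile M p"
    unfolding quantile_def using assms by (intro cInf_greatest) auto
  show "quantile M p \<le> u"
    unfolding quantile_def using assms by (intro cInf_lower bdd_belowI[of _ l]) auto
qed

text \<open>
  The lower bound for the Gaussian critical values: inverting the lower tail bound gives
  \<open>exp (- ((y + 1)\<^sup>2 / 2)) \<le> 3 * \<alpha>\<close> for every \<open>y\<close> whose upper tail has mass at most \<open>\<alpha>\<close>.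
\<close>

definition crit_lower :: "real \<Rightarrow> real" where
  "crit_lower \<alpha> = sqrt (2 * ln (1 / (3 * \<alpha>))) - 1"

lemma crit_lower_le:
  assumes "0 < \<alpha>" and pos: "crit_lower \<alpha> > 0" and y: "1 - \<alpha> \<le> measure (gauss \<mu>) {..\<mu> + y}"
  shows "crit_lower \<alpha> \<le> y"
proof -
  interpret M: prob_space "gauss \<mu>" by (rule prob_space_normal_density) simp
  \<comment> \<open>The tail bound needs a nonnegative argument; positivity of the bound rules out \<open>y < 0\<close> at the end.\<close>
  define w where "w = max y 0"
  have "w \<ge> 0" by (simp add: w_def)
  have "measure (gauss \<mu>) {..\<mu> + y} \<le> measure (gauss \<mu>) {..\<mu> + w}"
    by (intro M.finite_measure_mono) (auto simp: w_def)
  moreover have "measure (gauss \<mu>) {\<mu> + w<..} = 1 - measure (gauss \<mu>) {..\<mu> + w}"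
    using M.prob_compl[of "{..\<mu> + w}"] by (simp add: Compl_eq_Diff_UNIV[symmetric])
  ultimately have "exp (- ((w + 1)\<^sup>2 / 2)) / 3 \<le> \<alpha>"
    using gauss_tail_lower_bound[OF \<open>w \<ge> 0\<close>, of \<mu>] y by linarith
  then have "exp (- ((w + 1)\<^sup>2 / 2)) \<le> 3 * \<alpha>" by simp
  then have "- ((w + 1)\<^sup>2 / 2) \<le> ln (3 * \<alpha>)"
    using \<open>0 < \<alpha>\<close> by (simp add: ln_ge_iff)
  then have "2 * ln (1 / (3 * \<alpha>)) \<le> (w + 1)\<^sup>2"
    using \<open>0 < \<alpha>\<close> by (simp add: ln_div)
  then have "sqrt (2 * ln (1 / (3 * \<alpha>))) \<le> w + 1"
    using \<open>w \<ge> 0\<close> by (intro real_le_lsqrt) auto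
  then show ?thesis
    using pos by (auto simp: crit_lower_def w_def max_def split: if_splits)
qed

lemma z_quantile_bounds:
  assumes "0 < \<alpha>" "\<alpha> < 1" "crit_lower \<alpha> > 0"
  shows "crit_lower \<alpha> \<le> z_quantile (1 - \<alpha>)" "z_quantile (1 - \<alpha>) \<le> sqrt (2 * ln (1 / \<alpha>))"
proof -
  interpret M: prob_space "gauss 0" by (rule prob_space_normal_density) simp
  let ?b = "sqrt (2 * ln (1 / \<alpha>))"
  have lower: "crit_lower \<alpha> \<le> y" if "1 - \<alpha> \<le> cdf std_normal_distribution y" for y
    using crit_lower_le[of \<alpha> 0 y] that assms by (simp add: cdf_def)
  have b: "?b \<ge> 0" "exp (- (?b\<^sup>2 / 2)) = \<alpha>"
    using assms by (auto simp: ln_div)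
  have "measure (gauss 0) {?b<..} \<le> exp (- (?b\<^sup>2 / 2))"
    using b(1) by (intro gauss_chernoff mult_nonneg_nonneg) auto
  moreover have "measure (gauss 0) {?b<..} = 1 - measure (gauss 0) {..?b}"
    using M.prob_compl[of "{..?b}"] by (simp add: Compl_eq_Diff_UNIV[symmetric])
  ultimately have upper: "1 - \<alpha> \<le> cdf std_normal_distribution ?b"
    unfolding b(2) by (simp add: cdf_def)
  show "crit_lower \<alpha> \<le> z_quantile (1 - \<alpha>)" "z_quantile (1 - \<alpha>) \<le> ?b"
    unfolding z_quantile_def by (rule quantile_between[OF lower upper]; assumption)+
qed

text \<open>
  A bias \<open>t\<close> shifts the critical value by essentially \<open>t\<close>.  For the lower bound the left tail of
  \<open>N(t, 1)\<close>, folded onto the right one, is discarded.  For the upper bound both tails are charged \<open>\<alpha> / 2\<close>; the left tail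
  starts at \<open>- (t + b)\<close>, which is at distance at least \<open>b\<close> from the mean.
\<close>

lemma cv_bounds:
  assumes "0 < \<alpha>" "\<alpha> < 1" "crit_lower \<alpha> > 0" "t \<ge> 0"
  shows "t + crit_lower \<alpha> \<le> cv (1 - \<alpha>) t" "cv (1 - \<alpha>) t \<le> t + sqrt (2 * ln (2 / \<alpha>))"
proof -
  interpret M: prob_space "gauss t" by (rule prob_space_normal_density) simp
  let ?b = "sqrt (2 * ln (2 / \<alpha>))"
  have cdf: "cdf (folded_normal t) c = measure (gauss t) {y. \<bar>y\<bar> \<le> c}" for c
    by (simp add: cdf_def folded_normal_def measure_distr vimage_def)
  have lower: "t + crit_lower \<alpha> \<le> y" if "1 - \<alpha> \<le> cdf (folded_normal t) y" for y
  proof -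
    have "cdf (folded_normal t) y \<le> measure (gauss t) {..t + (y - t)}"
      unfolding cdf by (intro M.finite_measure_mono) auto
    then have "crit_lower \<alpha> \<le> y - t"
      using that assms by (intro crit_lower_le[of \<alpha> t]) auto
    then show ?thesis by simp
  qed
  have "ln (2 / \<alpha>) \<ge> 0" using assms by simp
  then have b: "?b \<ge> 0" "exp (- (?b\<^sup>2 / 2)) = \<alpha> / 2"
    using assms by (auto simp: exp_minus)
  have "measure (gauss t) {t + ?b<..} \<le> exp (- (?b\<^sup>2 / 2))"
    using b(1) by (intro gauss_chernoff mult_nonneg_nonneg) auto
  moreover have "measure (gauss t) {..< - (t + ?b)} \<le> exp (- ((- ?b)\<^sup>2 / 2))"
    using b(1) assms by (intro gauss_chernoff mult_nonpos_nonpos) auto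
  moreover have "measure (gauss t) ({t + ?b<..} \<union> {..< - (t + ?b)})
                   \<le> measure (gauss t) {t + ?b<..} + measure (gauss t) {..< - (t + ?b)}"
    by (intro measure_Un_le) auto
  moreover have "measure (gauss t) ({t + ?b<..} \<union> {..< - (t + ?b)})
                   = 1 - measure (gauss t) {y. \<bar>y\<bar> \<le> t + ?b}"
  proof -
    have "{t + ?b<..} \<union> {..< - (t + ?b)} = space (gauss t) - {y. \<bar>y\<bar> \<le> t + ?b}"
      by auto
    then show ?thesis
      using M.prob_compl[of "{y. \<bar>y\<bar> \<le> t + ?b}"] by simp
  qed
  ultimately have upper: "1 - \<alpha> \<le> cdf (folded_normal t) (t + ?b)"
    unfolding cdf power2_minus b(2) by simp
  show "t + crit_lower \<alpha> \<le> cv (1 - \<alpha>) t" "cv (1 - \<alpha>) t \<le> t + ?b"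
    unfolding cv_def by (rule quantile_between[OF lower upper]; assumption)+
qed

section \<open>Radii with a fixed critical value\<close>

definition radius :: "nat \<Rightarrow> real \<Rightarrow> real \<Rightarrow> real" where
  "radius S \<eta> u = (INF h\<in>{0<..}. \<eta> * h ^ S + u / sqrt h)"

lemma radius_bdd_below:
  assumes "\<eta> \<ge> 0" "u \<ge> 0"
  shows "bdd_below ((\<lambda>h. \<eta> * h ^ S + u / sqrt h) ` {0<..})"
  using assms by (intro bdd_belowI[of _ 0]) auto

text \<open>
  Either the bias term (for \<open>h \<ge> 1\<close>) or the stochastic term (for \<open>h \<le> 1\<close>) is bounded away from zero.
\<close>

lemma radius_pos:
  assumes "\<eta> > 0" "u > 0"
  shows "radius S \<eta> u > 0"
proof -
  have "min \<eta> u \<le> \<eta> * h ^ S + u / sqrt h" if "h > 0" for h :: real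
  proof (cases "h \<ge> 1")
    case True
    then have "\<eta> * 1 \<le> \<eta> * h ^ S"
      using assms by (intro mult_left_mono one_le_power) auto
    moreover have "0 \<le> u / sqrt h" using assms that by simp
    ultimately show ?thesis by linarith
  next
    case False
    then have "u / 1 \<le> u / sqrt h"
      using assms that by (intro divide_left_mono) auto
    moreover have "0 \<le> \<eta> * h ^ S" using assms that by simp
    ultimately show ?thesis by linarith
  qed
  then have "min \<eta> u \<le> radius S \<eta> u"
    unfolding radius_def by (intro cINF_greatest) auto
  then show ?thesis using assms by linarith
qed

lemma radius_mult_le:
  assumes "\<eta> \<ge> 0" "u \<ge> 0" "l \<ge> 1"
  shows "radius S \<eta> (l * u) \<le> l * radius S \<eta> u"
proof -
  have "radius S \<eta> (l * u) / l \<le> radius S \<eta> u"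
    unfolding radius_def[of S \<eta> u]
  proof (rule cINF_greatest)
    fix h :: real assume h: "h \<in> {0<..}"
    have "radius S \<eta> (l * u) \<le> \<eta> * h ^ S + l * u / sqrt h"
      unfolding radius_def using assms h by (intro cINF_lower radius_bdd_below) auto
    also have "\<dots> \<le> l * (\<eta> * h ^ S) + l * u / sqrt h"
      using mult_right_mono[of 1 l "\<eta> * h ^ S"] assms h by simp
    also have "\<dots> = l * (\<eta> * h ^ S + u / sqrt h)"
      by (simp add: algebra_simps)
    finally show "radius S \<eta> (l * u) / l \<le> \<eta> * h ^ S + u / sqrt h"
      using assms by (simp add: field_simps)
  qed auto
  then show ?thesis using assms by (simp add: field_simps)
qed

text \<open>
  For the FLCI radii \<open>f h\<close> is the half-length at bandwidth \<open>h\<close>, and \<open>u\<close>, \<open>v\<close> come from the bounds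
  on the critical values.
\<close>

lemma radius_sandwich:
  fixes f :: "real \<Rightarrow> real"
  assumes "\<eta> \<ge> 0" "u \<ge> 0"
    and lower: "\<And>h. h > 0 \<Longrightarrow> \<eta> * h ^ S + u / sqrt h \<le> f h"
    and upper: "\<And>h. h > 0 \<Longrightarrow> f h \<le> \<eta> * h ^ S + v / sqrt h"
  shows "radius S \<eta> u \<le> (INF h\<in>{0<..}. f h)" and "(INF h\<in>{0<..}. f h) \<le> radius S \<eta> v"
proof -
  show "radius S \<eta> u \<le> (INF h\<in>{0<..}. f h)"
    unfolding radius_def using assms by (intro cINF_mono radius_bdd_below) auto
  have "0 \<le> f h" if "h > 0" for h
    using lower[OF that] assms that by (smt (verit) divide_nonneg_nonneg mult_nonneg_nonneg
      real_sqrt_ge_zero zero_le_power)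
  then have "bdd_below (f ` {0<..})"
    by (intro bdd_belowI[of _ 0]) auto
  then show "(INF h\<in>{0<..}. f h) \<le> radius S \<eta> v"
    unfolding radius_def using upper by (intro cINF_mono) auto
qed

text \<open>
  Rescaling the critical value by \<open>v / u\<close> rescales the radius by at most the same factor, so a
  sandwich between radii with asymptotically equal critical values determines ratios.
\<close>

lemma radius_ratio_bounds:
  assumes "\<eta> > 0" "0 < u" "u \<le> v" "radius S \<eta> u \<le> R" "R \<le> radius S \<eta> v"
  shows "1 \<le> radius S \<eta> v / R" "radius S \<eta> v / R \<le> v / u"
proof -
  have pos: "0 < radius S \<eta> u" using assms by (intro radius_pos)
  then show "1 \<le> radius S \<eta> v / R" using assms by simp
  have "radius S \<eta> v = radius S \<eta> (v / u * u)" using assms by simp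
  also have "\<dots> \<le> v / u * radius S \<eta> u" using assms by (intro radius_mult_le) auto
  also have "\<dots> \<le> v / u * R" using assms by (intro mult_left_mono) auto
  finally show "radius S \<eta> v / R \<le> v / u" using assms pos by (simp add: pos_divide_le_eq)
qed

section \<open>Comparison of the interval radii\<close>

lemma ebci_radius1_eq_radius:
  assumes "n \<ge> 1" "C > 0"
  shows "ebci_radius1 S n C \<alpha> \<eta> = radius S \<eta> (sqrt (C / real n) * sqrt (2 * ln (1 / \<alpha>)))"
  unfolding ebci_radius1_def radius_def
  by (simp add: real_sqrt_mult real_sqrt_divide mult_ac add.commute)

lemma flci_radius1_sandwich:
  assumes "0 < \<alpha>" "\<alpha> < 1" "crit_lower \<alpha> > 0" "\<eta> > 0" "a > 0"
    and \<sigma>: "\<And>h. h > 0 \<Longrightarrow> \<sigma> h = a / sqrt h"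
  shows "radius S \<eta> (a * crit_lower \<alpha>) \<le> flci_radius1 S \<sigma> \<alpha> \<eta>"
    and "flci_radius1 S \<sigma> \<alpha> \<eta> \<le> radius S \<eta> (a * sqrt (2 * ln (1 / \<alpha>)))"
proof -
  have bounds:
    "\<eta> * h ^ S + a * crit_lower \<alpha> / sqrt h \<le> \<eta> * h ^ S + \<sigma> h * z_quantile (1 - \<alpha>)"
    "\<eta> * h ^ S + \<sigma> h * z_quantile (1 - \<alpha>) \<le> \<eta> * h ^ S + a * sqrt (2 * ln (1 / \<alpha>)) / sqrt h"
    if "h > 0" for h
    using mult_left_mono[OF z_quantile_bounds(1)[OF assms(1-3)], of "a / sqrt h"]
      mult_left_mono[OF z_quantile_bounds(2)[OF assms(1-3)], of "a / sqrt h"] that assms(5)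
    by (simp_all add: \<sigma>)
  then show "radius S \<eta> (a * crit_lower \<alpha>) \<le> flci_radius1 S \<sigma> \<alpha> \<eta>"
    and "flci_radius1 S \<sigma> \<alpha> \<eta> \<le> radius S \<eta> (a * sqrt (2 * ln (1 / \<alpha>)))"
    unfolding flci_radius1_def
    using radius_sandwich[where u = "a * crit_lower \<alpha>", OF _ _ bounds] assms by simp_all
qed

lemma flci_radius2_sandwich:
  assumes "0 < \<alpha>" "\<alpha> < 1" "crit_lower \<alpha> > 0" "\<eta> > 0" "a > 0"
    and \<sigma>: "\<And>h. h > 0 \<Longrightarrow> \<sigma> h = a / sqrt h"
  shows "radius S \<eta> (a * crit_lower \<alpha>) \<le> flci_radius2 S \<sigma> \<alpha> \<eta>"
    and "flci_radius2 S \<sigma> \<alpha> \<eta> \<le> radius S \<eta> (a * sqrt (2 * ln (2 / \<alpha>)))"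
proof -
  have bounds:
    "\<eta> * h ^ S + a * crit_lower \<alpha> / sqrt h \<le> \<sigma> h * cv (1 - \<alpha>) (\<eta> * h ^ S / \<sigma> h)"
    "\<sigma> h * cv (1 - \<alpha>) (\<eta> * h ^ S / \<sigma> h) \<le> \<eta> * h ^ S + a * sqrt (2 * ln (2 / \<alpha>)) / sqrt h"
    if h: "h > 0" for h
  proof -
    have s: "\<sigma> h > 0" using h assms by simp
    then have t: "\<eta> * h ^ S / \<sigma> h \<ge> 0" using h assms by simp
    \<comment> \<open>The bias-to-noise ratio, scaled back by \<open>\<sigma> h\<close>, is the bias.\<close>
    have shift: "\<sigma> h * (\<eta> * h ^ S / \<sigma> h + c) = \<eta> * h ^ S + a * c / sqrt h" for c
      using s h by (simp add: distrib_left) (simp add: \<sigma>)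
    show "\<eta> * h ^ S + a * crit_lower \<alpha> / sqrt h \<le> \<sigma> h * cv (1 - \<alpha>) (\<eta> * h ^ S / \<sigma> h)"
      "\<sigma> h * cv (1 - \<alpha>) (\<eta> * h ^ S / \<sigma> h) \<le> \<eta> * h ^ S + a * sqrt (2 * ln (2 / \<alpha>)) / sqrt h"
      unfolding shift[symmetric] using s cv_bounds[OF assms(1-3) t]
      by (auto intro: mult_left_mono)
  qed
  then show "radius S \<eta> (a * crit_lower \<alpha>) \<le> flci_radius2 S \<sigma> \<alpha> \<eta>"
    and "flci_radius2 S \<sigma> \<alpha> \<eta> \<le> radius S \<eta> (a * sqrt (2 * ln (2 / \<alpha>)))"
    unfolding flci_radius2_def
    using radius_sandwich[where u = "a * crit_lower \<alpha>", OF _ _ bounds] assms by simp_all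
qed

text \<open>
  The constants \<open>k\<close>, \<open>3\<close> and \<open>- 1\<close> are of lower order than \<open>sqrt (2 * ln (1 / \<alpha>))\<close>.
\<close>

lemma radius_ratio_tendsto_1:
  fixes k :: real
  assumes "\<eta> > 0" "a > 0" "k \<ge> 1"
    and R: "\<And>\<alpha>. 0 < \<alpha> \<Longrightarrow> \<alpha> < 1 \<Longrightarrow> crit_lower \<alpha> > 0 \<Longrightarrow>
              radius S \<eta> (a * crit_lower \<alpha>) \<le> R \<alpha> \<and> R \<alpha> \<le> radius S \<eta> (a * sqrt (2 * ln (k / \<alpha>)))"
  shows "((\<lambda>\<alpha>. radius S \<eta> (a * sqrt (2 * ln (k / \<alpha>))) / R \<alpha>) \<longlongrightarrow> 1) (at_right 0)"
proof -
  have "k > 0" using assms by simp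
  have lim: "((\<lambda>\<alpha>. sqrt (2 * ln (k / \<alpha>)) / crit_lower \<alpha>) \<longlongrightarrow> 1) (at_right 0)"
    unfolding crit_lower_def using \<open>k > 0\<close> by real_asymp
  have "\<forall>\<^sub>F \<alpha> in at_right 0. crit_lower \<alpha> > 0"
    unfolding crit_lower_def by real_asymp
  moreover have "\<forall>\<^sub>F \<alpha> in at_right 0. 0 < \<alpha> \<and> \<alpha> < (1::real)"
    using eventually_at_right_real[of 0 1] by simp
  ultimately have ev: "\<forall>\<^sub>F \<alpha> in at_right 0.
      1 \<le> radius S \<eta> (a * sqrt (2 * ln (k / \<alpha>))) / R \<alpha> \<and>
      radius S \<eta> (a * sqrt (2 * ln (k / \<alpha>))) / R \<alpha> \<le> sqrt (2 * ln (k / \<alpha>)) / crit_lower \<alpha>"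
  proof eventually_elim
    case (elim \<alpha>)
    have "1 / (3 * \<alpha>) \<le> k / \<alpha>"
      using elim assms by (simp add: field_simps)
    then have "ln (1 / (3 * \<alpha>)) \<le> ln (k / \<alpha>)"
      using elim \<open>k > 0\<close> by (simp add: ln_le_cancel_iff)
    then have "sqrt (2 * ln (1 / (3 * \<alpha>))) \<le> sqrt (2 * ln (k / \<alpha>))"
      by simp
    then have "crit_lower \<alpha> \<le> sqrt (2 * ln (k / \<alpha>))"
      unfolding crit_lower_def by linarith
    then show ?case
      using radius_ratio_bounds[of \<eta> "a * crit_lower \<alpha>" "a * sqrt (2 * ln (k / \<alpha>))" S "R \<alpha>"]
        R[of \<alpha>] elim assms by simp
  qed
  then show ?thesis
    by (intro tendsto_sandwich[OF _ _ tendsto_const lim]) (auto elim: eventually_mono)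
qed

lemma relative_error_smallo:
  fixes f g :: "'a \<Rightarrow> real"
  assumes f: "(f \<longlongrightarrow> 1) F" and g: "(g \<longlongrightarrow> 1) F"
  shows "\<exists>e\<in>o[F](\<lambda>_. 1). \<forall>\<^sub>F x in F. f x = g x * (1 + e x)"
proof (rule bexI[where x = "\<lambda>x. f x / g x - 1"])
  have "((\<lambda>x. f x / g x - 1) \<longlongrightarrow> 1 / 1 - 1) F"
    by (intro tendsto_intros f g) simp
  then show "(\<lambda>x. f x / g x - 1) \<in> o[F](\<lambda>_. 1)"
    by (intro smalloI_tendsto) auto
  have "\<forall>\<^sub>F x in F. g x > 0"
    using g by (rule order_tendstoD) simp
  then show "\<forall>\<^sub>F x in F. f x = g x * (1 + (f x / g x - 1))"
    by eventually_elim simp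
qed


theorem proposition4:
  fixes S n :: nat and x\<^sub>0 M\<^sub>S \<eta> C\<^sub>V :: real and r\<^sub>S \<sigma> :: "real \<Rightarrow> real"
    and P :: "(real \<Rightarrow> real) \<Rightarrow> 'w measure"
    and est :: "real \<Rightarrow> 'w \<Rightarrow> real"
    and \<Theta> :: "(real \<Rightarrow> real) set"
  assumes "S \<ge> 1" and "n \<ge> 1"
    and "M\<^sub>S > 0"
    and "\<And>t. t \<ge> 0 \<Longrightarrow> r\<^sub>S t \<ge> 0"
    and "mono_on {0..} r\<^sub>S"
    and "(r\<^sub>S \<longlongrightarrow> 0) (at_right 0)"
    and "\<Theta> = taylor_class S x\<^sub>0 M\<^sub>S r\<^sub>S (window S n)"
    and "\<And>\<theta>. \<theta> \<in> \<Theta> \<Longrightarrow> prob_space (P \<theta>)"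
    and "\<And>\<theta> h. \<theta> \<in> \<Theta> \<Longrightarrow> h > 0 \<Longrightarrow> est h \<in> borel_measurable (P \<theta>)"
    and "\<And>\<theta> h. \<theta> \<in> \<Theta> \<Longrightarrow> h > 0 \<Longrightarrow> integrable (P \<theta>) (\<lambda>\<omega>. (est h \<omega>)\<^sup>2)"
    and "\<eta> > 0" and "C\<^sub>V > 0"
    and "\<And>h. h > 0 \<Longrightarrow>
           (SUP \<theta>\<in>\<Theta>. ereal \<bar>prob_space.expectation (P \<theta>) (est h) - \<theta> x\<^sub>0\<bar>) = ereal (\<eta> * h ^ S)"
    and "\<And>\<theta> h. \<theta> \<in> \<Theta> \<Longrightarrow> h > 0 \<Longrightarrow> \<sigma> h = sqrt (prob_space.variance (P \<theta>) (est h))"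
    and "\<And>h. h > 0 \<Longrightarrow> \<sigma> h = sqrt (C\<^sub>V / (real n * h))"
  shows "(\<exists>e \<in> o[at_right 0](\<lambda>_. 1). \<forall>\<^sub>F \<alpha> in at_right 0.
            ebci_radius1 S n C\<^sub>V \<alpha> \<eta> / flci_radius1 S \<sigma> \<alpha> \<eta> = 1 + e \<alpha>) \<and>
         (\<exists>e \<in> o[at_right 0](\<lambda>_. 1). \<forall>\<^sub>F \<alpha> in at_right 0.
            ebci_radius2 S n C\<^sub>V \<alpha> \<eta> / flci_radius2 S \<sigma> \<alpha> \<eta> =
              (ln (2 / \<alpha>) / ln (1 / \<alpha>)) powr (real S / (2 * real S + 1)) * (1 + e \<alpha>))"
proof -
  define a where "a = sqrt (C\<^sub>V / real n)"
  have a: "a > 0"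
    using assms(2,12) by (simp add: a_def)
  have \<sigma>: "\<sigma> h = a / sqrt h" if "h > 0" for h
    using assms(15)[OF that] by (simp add: a_def real_sqrt_mult real_sqrt_divide)
  have ratio1: "((\<lambda>\<alpha>. ebci_radius1 S n C\<^sub>V \<alpha> \<eta> / flci_radius1 S \<sigma> \<alpha> \<eta>) \<longlongrightarrow> 1) (at_right 0)"
    unfolding ebci_radius1_eq_radius[OF assms(2,12)] a_def[symmetric]
    using a assms(11) \<sigma> by (intro radius_ratio_tendsto_1 conjI flci_radius1_sandwich) auto
  have ratio2: "((\<lambda>\<alpha>. ebci_radius2 S n C\<^sub>V \<alpha> \<eta> / flci_radius2 S \<sigma> \<alpha> \<eta>) \<longlongrightarrow> 1) (at_right 0)"
    unfolding ebci_radius2_def ebci_radius1_eq_radius[OF assms(2,12)] a_def[symmetric]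
      divide_divide_eq_right mult_1
    using a assms(11) \<sigma> by (intro radius_ratio_tendsto_1 conjI flci_radius2_sandwich) auto
  have "((\<lambda>\<alpha>::real. ln (2 / \<alpha>) / ln (1 / \<alpha>)) \<longlongrightarrow> 1) (at_right 0)"
    by real_asymp
  then have factor: "((\<lambda>\<alpha>. (ln (2 / \<alpha>) / ln (1 / \<alpha>)) powr (real S / (2 * real S + 1))) \<longlongrightarrow> 1)
      (at_right 0)"
    using tendsto_powr[OF _ tendsto_const, of _ 1] by fastforce
  show ?thesis
    using relative_error_smallo[OF ratio1 tendsto_const] relative_error_smallo[OF ratio2 factor]
    by simp
qed

end
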